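(* Let $\alpha:I\to E^3$ be a Frenet curve having an evolute-direction curve $\beta$. The following statements are equivalent: (i) $\alpha$ is a plane curve. (ii) $\alpha$ is an involute-donor curve of a helix. (iii) An evolute-direction curve of $\alpha$ is a helix.
   Context: $I\subset\mathbb{R}$ is an open interval and curves are smooth. A unit speed curve $\alpha:I\to E^3$ is a Frenet curve if its curvature $\kappa=\|\alpha''\|$ is nowhere zero; then $T=\alpha'$, $N=\alpha''/\kappa$, $B=T\times N$, and $T'=\kappa N$, $N'=-\kappa T+\tau B$, $B'=-\tau N$, where $\tau$ is the torsion. For a unit vector field $X(s)=a(s)T(s)+b(s)N(s)+c(s)B(s)$ with $a,b,c$ smooth and $a^2+b^2+c^2=1$, an $X$-direction curve of $\alpha$ is a curve $\beta:I\to E^3$ with $\beta'(s)=X(s)$; the parameter $s$ is then also arc length for $\beta$, whose Frenet apparatus is $\{\overline T,\overline N,\overline B\},\overline\kappa,\overline\tau$. An $X$-direction curve $\beta$ of $\alpha$ (for some such $X$) is called an evolute-direction curve of $\alpha$ if it is an evolute of $\alpha$, in the sense that $\beta$ is a Frenet curve with $\langle\overline T,T\rangle=0$ and $\overline N=T$ at each common parameter value $s$; then $\alpha$ is called an involute-donor curve of $\beta$. A Frenet curve is a (general) helix if the ratio of its torsion to its curvature is constant. *)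

theory Defs
  imports "HOL-Analysis.Analysis"
begin

text \<open>
  A curve on an open interval \<open>I\<close> is a total function on the reals of which only the values
  on \<open>I\<close> matter. Since \<open>I\<close> is open, the two-sided derivative at a point of \<open>I\<close> depends only
  on these values.
\<close>

definition open_interval :: "real set \<Rightarrow> bool" where
  "open_interval I \<longleftrightarrow> open I \<and> is_interval I \<and> I \<noteq> {}"

definition vderiv :: "(real \<Rightarrow> 'a::real_normed_vector) \<Rightarrow> real \<Rightarrow> 'a" where
  "vderiv f = (\<lambda>s. vector_derivative f (at s))"

text \<open>Smoothness: every iterated derivative is itself differentiable on \<open>I\<close>.\<close>

definition smooth_on :: "real set \<Rightarrow> (real \<Rightarrow> 'a::real_normed_vector) \<Rightarrow> bool" where
  "smooth_on I f \<longleftrightarrow> (\<forall>n. \<forall>s\<in>I. (vderiv ^^ n) f differentiable (at s))"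

definition tangent :: "(real \<Rightarrow> real^3) \<Rightarrow> real \<Rightarrow> real^3" where
  "tangent \<alpha> = vderiv \<alpha>"

definition curvature :: "(real \<Rightarrow> real^3) \<Rightarrow> real \<Rightarrow> real" where
  "curvature \<alpha> s = norm (vderiv (vderiv \<alpha>) s)"

definition normal :: "(real \<Rightarrow> real^3) \<Rightarrow> real \<Rightarrow> real^3" where
  "normal \<alpha> s = (1 / curvature \<alpha> s) *\<^sub>R vderiv (vderiv \<alpha>) s"

definition binormal :: "(real \<Rightarrow> real^3) \<Rightarrow> real \<Rightarrow> real^3" where
  "binormal \<alpha> s = cross3 (tangent \<alpha> s) (normal \<alpha> s)"

text \<open>The coefficient in the third Frenet equation \<open>B' = - \<tau> N\<close>, with \<open>N\<close> of unit length.\<close>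

definition torsion :: "(real \<Rightarrow> real^3) \<Rightarrow> real \<Rightarrow> real" where
  "torsion \<alpha> s = - (vderiv (binormal \<alpha>) s \<bullet> normal \<alpha> s)"

definition frenet_curve :: "real set \<Rightarrow> (real \<Rightarrow> real^3) \<Rightarrow> bool" where
  "frenet_curve I \<alpha> \<longleftrightarrow> smooth_on I \<alpha> \<and>
     (\<forall>s\<in>I. norm (vderiv \<alpha> s) = 1) \<and> (\<forall>s\<in>I. curvature \<alpha> s \<noteq> 0)"

definition unit_frenet_field ::
    "real set \<Rightarrow> (real \<Rightarrow> real^3) \<Rightarrow> (real \<Rightarrow> real^3) \<Rightarrow> bool" where
  "unit_frenet_field I \<alpha> X \<longleftrightarrow>
     (\<exists>a b c :: real \<Rightarrow> real. smooth_on I a \<and> smooth_on I b \<and> smooth_on I c \<and>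
       (\<forall>s\<in>I. (a s)\<^sup>2 + (b s)\<^sup>2 + (c s)\<^sup>2 = 1 \<and>
         X s = a s *\<^sub>R tangent \<alpha> s + b s *\<^sub>R normal \<alpha> s + c s *\<^sub>R binormal \<alpha> s))"

definition direction_curve ::
    "real set \<Rightarrow> (real \<Rightarrow> real^3) \<Rightarrow> (real \<Rightarrow> real^3) \<Rightarrow> (real \<Rightarrow> real^3) \<Rightarrow> bool" where
  "direction_curve I \<alpha> X \<beta> \<longleftrightarrow> frenet_curve I \<alpha> \<and> unit_frenet_field I \<alpha> X \<and>
     smooth_on I \<beta> \<and> (\<forall>s\<in>I. (\<beta> has_vector_derivative X s) (at s))"

text \<open>In the following three predicates the curve \<open>\<alpha>\<close> is the first curve argument; thus
  \<open>is_evolute I \<alpha> \<beta>\<close> says that \<open>\<beta>\<close> is an evolute of \<open>\<alpha>\<close>.\<close>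

definition is_evolute :: "real set \<Rightarrow> (real \<Rightarrow> real^3) \<Rightarrow> (real \<Rightarrow> real^3) \<Rightarrow> bool" where
  "is_evolute I \<alpha> \<beta> \<longleftrightarrow> frenet_curve I \<beta> \<and>
     (\<forall>s\<in>I. tangent \<beta> s \<bullet> tangent \<alpha> s = 0 \<and> normal \<beta> s = tangent \<alpha> s)"

definition evolute_direction_curve ::
    "real set \<Rightarrow> (real \<Rightarrow> real^3) \<Rightarrow> (real \<Rightarrow> real^3) \<Rightarrow> bool" where
  "evolute_direction_curve I \<alpha> \<beta> \<longleftrightarrow> (\<exists>X. direction_curve I \<alpha> X \<beta>) \<and> is_evolute I \<alpha> \<beta>"

text \<open>\<open>\<alpha>\<close> is an involute-donor curve of \<open>\<beta>\<close>.\<close>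

definition involute_donor_curve ::
    "real set \<Rightarrow> (real \<Rightarrow> real^3) \<Rightarrow> (real \<Rightarrow> real^3) \<Rightarrow> bool" where
  "involute_donor_curve I \<alpha> \<beta> \<longleftrightarrow> evolute_direction_curve I \<alpha> \<beta>"

definition helix :: "real set \<Rightarrow> (real \<Rightarrow> real^3) \<Rightarrow> bool" where
  "helix I \<alpha> \<longleftrightarrow> frenet_curve I \<alpha> \<and> (\<exists>k. \<forall>s\<in>I. torsion \<alpha> s / curvature \<alpha> s = k)"

definition plane_curve :: "real set \<Rightarrow> (real \<Rightarrow> real^3) \<Rightarrow> bool" where
  "plane_curve I \<alpha> \<longleftrightarrow> (\<exists>P. affine P \<and> aff_dim P = 2 \<and> \<alpha> ` I \<subseteq> P)"

end

theory Submission
  imports Defs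
begin

text \<open>
  The unit tangent of \<open>\<alpha>\<close> is the principal normal of each of its evolute-direction curves \<open>\<gamma>\<close>.
  This turns the theorem into two statements about a fixed direction \<open>D \<noteq> 0\<close>.

  The curve \<open>\<alpha>\<close> is plane iff its tangents are orthogonal to some \<open>D\<close>, because that says that
  \<open>\<alpha> \<bullet> D\<close> is constant (\<open>plane_curve_iff_tangents_orthogonal\<close>). A Frenet curve \<open>\<gamma>\<close> is a helix
  iff its principal normals are orthogonal to some \<open>D\<close>. This is a form of Lancret's theorem
  (\<open>helix_iff_normals_orthogonal\<close>), and it follows from the Frenet equations
  \<open>T' = \<kappa> N\<close>, \<open>N' = - \<kappa> T + \<tau> B\<close>, \<open>B' = - \<tau> N\<close>: if \<open>\<tau> = k \<kappa>\<close>, the vector \<open>k T + B\<close> is constant; conversely,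
  orthogonality of all \<open>N\<close> to \<open>D\<close> makes \<open>T \<bullet> D\<close> and \<open>B \<bullet> D\<close> constant, and then differentiating
  \<open>N \<bullet> D = 0\<close> gives \<open>\<tau> (B \<bullet> D) = \<kappa> (T \<bullet> D)\<close>, where \<open>B \<bullet> D \<noteq> 0\<close>: otherwise \<open>D\<close> would be
  orthogonal to the whole frame.

  So for every evolute-direction curve \<open>\<gamma>\<close> of \<open>\<alpha>\<close>, the curve \<open>\<alpha>\<close> is plane iff \<open>\<gamma>\<close> is a helix.
  Since \<open>\<alpha>\<close> has such a curve, it does not matter whether the helix property is asked of
  one of them or of all.
\<close>

section \<open>Curves on an interval\<close>

lemma smooth_on_has_vector_derivative:
  assumes "smooth_on I f" "s \<in> I"
  shows "((vderiv ^^ n) f has_vector_derivative (vderiv ^^ Suc n) f s) (at s)"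
  using assms by (simp add: smooth_on_def vderiv_def vector_derivative_works)

lemmas has_vector_derivative_inner =
  bounded_bilinear.has_vector_derivative[OF bounded_bilinear_inner]

lemmas has_vector_derivative_cross3 =
  bounded_bilinear.has_vector_derivative
    [OF bilinear_conv_bounded_bilinear[THEN iffD1, OF bilinear_cross]]

lemma open_interval_const_iff_derivative_zero:
  fixes f :: "real \<Rightarrow> 'a::real_normed_vector"
  assumes "open_interval I"
    and "\<And>s. s \<in> I \<Longrightarrow> (f has_vector_derivative f' s) (at s)"
  shows "(\<exists>c. \<forall>s\<in>I. f s = c) \<longleftrightarrow> (\<forall>s\<in>I. f' s = 0)"
proof
  assume "\<exists>c. \<forall>s\<in>I. f s = c"
  then obtain c where c: "\<And>s. s \<in> I \<Longrightarrow> f s = c" by blast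
  show "\<forall>s\<in>I. f' s = 0"
  proof
    fix s assume s: "s \<in> I"
    have "(f has_vector_derivative 0) (at s)"
      using assms(1) s c
      by (intro has_vector_derivative_transform_within_open[OF has_vector_derivative_const[of c]])
         (auto simp: open_interval_def)
    then show "f' s = 0"
      using assms(2)[OF s] vector_derivative_unique_at by blast
  qed
next
  assume "\<forall>s\<in>I. f' s = 0"
  then have "(f has_vector_derivative 0) (at s within I)" if "s \<in> I" for s
    using assms(2)[OF that] that by (auto intro: has_vector_derivative_at_within)
  moreover have "convex I"
    using assms(1) by (simp add: open_interval_def is_interval_convex)
  ultimately show "\<exists>c. \<forall>s\<in>I. f s = c"
    using has_vector_derivative_zero_constant[of I f] by metis
qed

lemma plane_curve_iff_tangents_orthogonal:
  assumes "open_interval I" "smooth_on I \<alpha>"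
  shows "plane_curve I \<alpha> \<longleftrightarrow> (\<exists>D. D \<noteq> 0 \<and> (\<forall>s\<in>I. tangent \<alpha> s \<bullet> D = 0))"
proof -
  have "plane_curve I \<alpha> \<longleftrightarrow> (\<exists>D b. D \<noteq> 0 \<and> \<alpha> ` I \<subseteq> {x. D \<bullet> x = b})"
  proof
    assume "plane_curve I \<alpha>"
    then obtain P where P: "affine P" "aff_dim P = 2" "\<alpha> ` I \<subseteq> P"
      by (auto simp: plane_curve_def)
    then show "\<exists>D b. D \<noteq> 0 \<and> \<alpha> ` I \<subseteq> {x. D \<bullet> x = b}"
      using aff_dim_eq_hyperplane[of P] by (auto simp: affine_hull_eq[THEN iffD2])
  next
    assume "\<exists>D b. D \<noteq> 0 \<and> \<alpha> ` I \<subseteq> {x. D \<bullet> x = b}"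
    then obtain D b where D: "D \<noteq> 0" "\<alpha> ` I \<subseteq> {x. D \<bullet> x = b}" by blast
    then show "plane_curve I \<alpha>"
      unfolding plane_curve_def
      by (intro exI[of _ "{x. D \<bullet> x = b}"]) (simp add: affine_hyperplane)
  qed
  also have "\<dots> \<longleftrightarrow> (\<exists>D. D \<noteq> 0 \<and> (\<exists>b. \<forall>s\<in>I. \<alpha> s \<bullet> D = b))"
    by (auto simp: inner_commute image_subset_iff)
  also have "\<dots> \<longleftrightarrow> (\<exists>D. D \<noteq> 0 \<and> (\<forall>s\<in>I. tangent \<alpha> s \<bullet> D = 0))"
  proof -
    have "((\<lambda>s. \<alpha> s \<bullet> D) has_vector_derivative tangent \<alpha> s \<bullet> D) (at s)" if "s \<in> I" for D s
      using has_vector_derivative_inner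
          [OF smooth_on_has_vector_derivative[OF assms(2) that, of 0]
            has_vector_derivative_const[of D]]
      by (simp add: tangent_def)
    then have "(\<exists>b. \<forall>s\<in>I. \<alpha> s \<bullet> D = b) \<longleftrightarrow> (\<forall>s\<in>I. tangent \<alpha> s \<bullet> D = 0)" for D
      by (rule open_interval_const_iff_derivative_zero[OF assms(1)])
    then show ?thesis by simp
  qed
  finally show ?thesis .
qed

section \<open>The Frenet frame\<close>

text \<open>
  An orthonormal pair and its cross product span the space: by the Lagrange formula,
  \<open>x \<times> (u \<times> v)\<close> vanishes when \<open>x\<close> is orthogonal to \<open>u\<close> and \<open>v\<close>, so \<open>x\<close> is parallel to \<open>u \<times> v\<close>.
\<close>

lemma eq_zero_if_orthogonal_to_frame:
  fixes u v x :: "real^3"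
  assumes "u \<bullet> u = 1" "v \<bullet> v = 1" "u \<bullet> v = 0"
    and "x \<bullet> u = 0" "x \<bullet> v = 0" "x \<bullet> cross3 u v = 0"
  shows "x = 0"
proof -
  have "cross3 x (cross3 u v) = 0"
    using assms by (simp add: Lagrange)
  then have "x = 0 \<or> cross3 u v = 0"
    using norm_and_cross_eq_0 assms(6) by blast
  moreover have "cross3 u v \<bullet> cross3 u v = 1"
    using assms by (simp add: dot_cross inner_commute)
  ultimately show ?thesis by auto
qed

context
  fixes I :: "real set" and \<gamma> :: "real \<Rightarrow> real^3"
  assumes interval: "open_interval I" and frenet: "frenet_curve I \<gamma>"
begin

lemma curvature_pos: "s \<in> I \<Longrightarrow> curvature \<gamma> s > 0"
  using frenet by (auto simp: frenet_curve_def curvature_def)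

lemma tangent_has_derivative:
  assumes "s \<in> I"
  shows "(tangent \<gamma> has_vector_derivative curvature \<gamma> s *\<^sub>R normal \<gamma> s) (at s)"
proof -
  have "(vderiv \<gamma> has_vector_derivative vderiv (vderiv \<gamma>) s) (at s)"
    using smooth_on_has_vector_derivative[of I \<gamma> s 1] frenet assms
    by (simp add: frenet_curve_def)
  then show ?thesis
    using curvature_pos[OF assms] by (simp add: tangent_def normal_def)
qed

lemma tangent_unit: "s \<in> I \<Longrightarrow> tangent \<gamma> s \<bullet> tangent \<gamma> s = 1"
  using frenet by (simp add: frenet_curve_def tangent_def dot_square_norm)

lemma normal_unit: "s \<in> I \<Longrightarrow> normal \<gamma> s \<bullet> normal \<gamma> s = 1"
  using curvature_pos[of s]
  by (simp add: normal_def dot_square_norm curvature_def power2_eq_square)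

lemma tangent_orthogonal_normal:
  assumes "s \<in> I"
  shows "tangent \<gamma> s \<bullet> normal \<gamma> s = 0"
proof -
  have "\<forall>s\<in>I. tangent \<gamma> s \<bullet> (curvature \<gamma> s *\<^sub>R normal \<gamma> s)
      + (curvature \<gamma> s *\<^sub>R normal \<gamma> s) \<bullet> tangent \<gamma> s = 0"
    using open_interval_const_iff_derivative_zero[OF interval,
        OF has_vector_derivative_inner[OF tangent_has_derivative tangent_has_derivative]]
      tangent_unit by blast
  then show ?thesis
    using curvature_pos[OF assms] assms by (auto simp: inner_commute)
qed

lemma normal_has_vderiv:
  assumes "s \<in> I"
  shows "(normal \<gamma> has_vector_derivative vderiv (normal \<gamma>) s) (at s)"
proof -
  have acc: "vderiv (vderiv \<gamma>) differentiable (at s)"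
    using smooth_on_has_vector_derivative[of I \<gamma> s 2] frenet assms
    by (auto simp: frenet_curve_def numeral_2_eq_2 has_vector_derivative_def differentiable_def)
  have "vderiv (vderiv \<gamma>) s \<noteq> 0"
    using curvature_pos[OF assms] by (simp add: curvature_def)
  then have "(\<lambda>s. norm (vderiv (vderiv \<gamma>) s)) differentiable (at s)"
    using differentiable_chain_at[OF acc differentiable_norm_at] by (simp add: o_def)
  then have "curvature \<gamma> differentiable (at s)"
    by (simp add: curvature_def[abs_def])
  then have "normal \<gamma> differentiable (at s)"
    unfolding normal_def[abs_def] using acc curvature_pos[OF assms]
    by (intro differentiable_scaleR differentiable_divide) auto
  then show ?thesis
    by (simp add: vderiv_def vector_derivative_works)
qed

lemma binormal_has_vderiv:
  assumes "s \<in> I"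
  shows "(binormal \<gamma> has_vector_derivative cross3 (tangent \<gamma> s) (vderiv (normal \<gamma>) s)) (at s)"
  using has_vector_derivative_cross3
      [OF tangent_has_derivative[OF assms] normal_has_vderiv[OF assms]]
  by (simp add: binormal_def[abs_def] cross_mult_left)

lemma vderiv_binormal:
  "s \<in> I \<Longrightarrow> vderiv (binormal \<gamma>) s = cross3 (tangent \<gamma> s) (vderiv (normal \<gamma>) s)"
  using binormal_has_vderiv by (simp add: vderiv_def vector_derivative_at)

text \<open>
  The components of \<open>N'\<close> in the frame come from differentiating \<open>N \<bullet> T = 0\<close> and \<open>N \<bullet> N = 1\<close>;
  the component along \<open>B\<close> is the torsion by the invariance of the triple product
  under cyclic permutation.
\<close>

lemma normal_has_derivative:
  assumes "s \<in> I"
  shows "(normal \<gamma> has_vector_derivative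
    - curvature \<gamma> s *\<^sub>R tangent \<gamma> s + torsion \<gamma> s *\<^sub>R binormal \<gamma> s) (at s)"
proof -
  let ?T = "tangent \<gamma> s" and ?N = "normal \<gamma> s" and ?B = "binormal \<gamma> s"
    and ?N' = "vderiv (normal \<gamma>) s"
  note frame = tangent_unit[OF assms] normal_unit[OF assms] tangent_orthogonal_normal[OF assms]
  have "\<forall>s\<in>I. normal \<gamma> s \<bullet> vderiv (normal \<gamma>) s + vderiv (normal \<gamma>) s \<bullet> normal \<gamma> s = 0"
    using open_interval_const_iff_derivative_zero[OF interval,
        OF has_vector_derivative_inner[OF normal_has_vderiv normal_has_vderiv]]
      normal_unit by blast
  then have N: "?N' \<bullet> ?N = 0"
    using assms by (auto simp: inner_commute)
  have "\<forall>s\<in>I. tangent \<gamma> s \<bullet> vderiv (normal \<gamma>) s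
      + (curvature \<gamma> s *\<^sub>R normal \<gamma> s) \<bullet> normal \<gamma> s = 0"
    using open_interval_const_iff_derivative_zero[OF interval,
        OF has_vector_derivative_inner[OF tangent_has_derivative normal_has_vderiv]]
      tangent_orthogonal_normal by blast
  then have T: "?N' \<bullet> ?T = - curvature \<gamma> s"
    using assms frame by (auto simp: inner_commute)
  have B: "?N' \<bullet> cross3 ?T ?N = torsion \<gamma> s"
    using cross_triple[of ?T ?N ?N'] cross_triple[of ?T ?N' ?N] cross_skew[of ?N ?N']
    by (simp add: torsion_def vderiv_binormal[OF assms] inner_commute)
  have BB: "cross3 ?T ?N \<bullet> cross3 ?T ?N = 1"
    using frame by (simp add: dot_cross inner_commute)
  have "?N' - (- curvature \<gamma> s *\<^sub>R ?T + torsion \<gamma> s *\<^sub>R ?B) = 0"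
    by (rule eq_zero_if_orthogonal_to_frame[OF frame])
       (use frame N T B BB in \<open>simp_all add: binormal_def inner_diff_left inner_add_left
          dot_cross_self inner_commute[of ?N ?T]\<close>)
  then show ?thesis
    using normal_has_vderiv[OF assms] by simp
qed

lemma binormal_has_derivative:
  assumes "s \<in> I"
  shows "(binormal \<gamma> has_vector_derivative - torsion \<gamma> s *\<^sub>R normal \<gamma> s) (at s)"
proof -
  have "vderiv (normal \<gamma>) s = - curvature \<gamma> s *\<^sub>R tangent \<gamma> s + torsion \<gamma> s *\<^sub>R binormal \<gamma> s"
    using normal_has_derivative[OF assms] by (simp add: vderiv_def vector_derivative_at)
  then have "cross3 (tangent \<gamma> s) (vderiv (normal \<gamma>) s) = - torsion \<gamma> s *\<^sub>R normal \<gamma> s"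
    using tangent_unit[OF assms] tangent_orthogonal_normal[OF assms]
    by (simp add: cross_add_right Cross3.right_diff_distrib cross_mult_right binormal_def Lagrange)
  then show ?thesis
    using binormal_has_vderiv[OF assms] by simp
qed

section \<open>Lancret's theorem\<close>

text \<open>
  The direction \<open>D\<close> is the axis of the helix. For \<open>\<tau> = k \<kappa>\<close> it is \<open>k T + B\<close>, which is nonzero
  because its component along \<open>B\<close> is \<open>1\<close>. In the other direction, the constant torsion-curvature
  ratio is \<open>(T \<bullet> D) / (B \<bullet> D)\<close>.
\<close>

lemma helix_iff_normals_orthogonal:
  "helix I \<gamma> \<longleftrightarrow> (\<exists>D. D \<noteq> 0 \<and> (\<forall>s\<in>I. normal \<gamma> s \<bullet> D = 0))"
proof
  assume "helix I \<gamma>"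
  then obtain k where "\<forall>s\<in>I. torsion \<gamma> s / curvature \<gamma> s = k"
    by (auto simp: helix_def)
  then have k: "torsion \<gamma> s = k * curvature \<gamma> s" if "s \<in> I" for s
    using curvature_pos[OF that] that by (auto simp: field_simps)
  have "((\<lambda>s. k *\<^sub>R tangent \<gamma> s + binormal \<gamma> s) has_vector_derivative 0) (at s)" if "s \<in> I" for s
    using has_vector_derivative_add[OF
        bounded_linear.has_vector_derivative[OF bounded_linear_scaleR_right,
          OF tangent_has_derivative[OF that], of k]
        binormal_has_derivative[OF that]] k[OF that] by simp
  then obtain D where D: "\<And>s. s \<in> I \<Longrightarrow> k *\<^sub>R tangent \<gamma> s + binormal \<gamma> s = D"
    using open_interval_const_iff_derivative_zero
        [OF interval, of "\<lambda>s. k *\<^sub>R tangent \<gamma> s + binormal \<gamma> s" "\<lambda>_. 0"]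
    by auto
  have "normal \<gamma> s \<bullet> D = 0" if "s \<in> I" for s
    using tangent_orthogonal_normal[OF that]
    by (simp add: D[OF that, symmetric] binormal_def inner_add_right dot_cross_self inner_commute)
  moreover have "D \<noteq> 0"
  proof
    assume "D = 0"
    obtain s where s: "s \<in> I"
      using interval by (auto simp: open_interval_def)
    have "binormal \<gamma> s \<bullet> D = 1"
      using tangent_unit[OF s] normal_unit[OF s] tangent_orthogonal_normal[OF s]
      by (simp add: D[OF s, symmetric] binormal_def inner_add_right dot_cross dot_cross_self
          inner_commute)
    with \<open>D = 0\<close> show False by simp
  qed
  ultimately show "\<exists>D. D \<noteq> 0 \<and> (\<forall>s\<in>I. normal \<gamma> s \<bullet> D = 0)" by blast
next
  assume "\<exists>D. D \<noteq> 0 \<and> (\<forall>s\<in>I. normal \<gamma> s \<bullet> D = 0)"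
  then obtain D where "D \<noteq> 0" and N: "\<And>s. s \<in> I \<Longrightarrow> normal \<gamma> s \<bullet> D = 0" by blast
  have inner_D: "((\<lambda>s. f s \<bullet> D) has_vector_derivative f' \<bullet> D) (at s)"
    if "(f has_vector_derivative f') (at s)" for f :: "real \<Rightarrow> real^3" and f' s
    using has_vector_derivative_inner[OF that has_vector_derivative_const[of D]] by simp
  obtain p where p: "\<And>s. s \<in> I \<Longrightarrow> tangent \<gamma> s \<bullet> D = p"
    using open_interval_const_iff_derivative_zero[OF interval,
        OF inner_D[OF tangent_has_derivative]] N by auto
  obtain q where q: "\<And>s. s \<in> I \<Longrightarrow> binormal \<gamma> s \<bullet> D = q"
    using open_interval_const_iff_derivative_zero[OF interval,
        OF inner_D[OF binormal_has_derivative]] N by auto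
  have "\<forall>s\<in>I. (- curvature \<gamma> s *\<^sub>R tangent \<gamma> s + torsion \<gamma> s *\<^sub>R binormal \<gamma> s) \<bullet> D = 0"
    using open_interval_const_iff_derivative_zero[OF interval,
        OF inner_D[OF normal_has_derivative]] N by blast
  then have pq: "torsion \<gamma> s * q = curvature \<gamma> s * p" if "s \<in> I" for s
    using that p[OF that] q[OF that] by (auto simp: inner_diff_left)
  have "q \<noteq> 0"
  proof
    assume "q = 0"
    obtain s where s: "s \<in> I"
      using interval by (auto simp: open_interval_def)
    have "p = 0"
      using pq[OF s] curvature_pos[OF s] \<open>q = 0\<close> by simp
    then have "D = 0"
      using eq_zero_if_orthogonal_to_frame[OF tangent_unit[OF s] normal_unit[OF s]
          tangent_orthogonal_normal[OF s], of D] p[OF s] q[OF s] N[OF s] \<open>q = 0\<close>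
      by (simp add: binormal_def inner_commute)
    with \<open>D \<noteq> 0\<close> show False by simp
  qed
  then have "torsion \<gamma> s / curvature \<gamma> s = p / q" if "s \<in> I" for s
    using pq[OF that] curvature_pos[OF that] by (simp add: field_simps)
  then show "helix I \<gamma>"
    using frenet by (auto simp: helix_def)
qed

end

section \<open>Evolute-direction curves\<close>

lemma plane_curve_iff_evolute_direction_helix:
  assumes "open_interval I" "evolute_direction_curve I \<alpha> \<gamma>"
  shows "plane_curve I \<alpha> \<longleftrightarrow> helix I \<gamma>"
proof -
  have "smooth_on I \<alpha>" "frenet_curve I \<gamma>" "\<forall>s\<in>I. normal \<gamma> s = tangent \<alpha> s"
    using assms(2)
    by (auto simp: evolute_direction_curve_def direction_curve_def is_evolute_def
        frenet_curve_def[of I \<alpha>])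
  then show ?thesis
    using plane_curve_iff_tangents_orthogonal[OF assms(1)]
      helix_iff_normals_orthogonal[OF assms(1)] by simp
qed

theorem theorem3p8:
  fixes I :: "real set" and \<alpha> \<beta> :: "real \<Rightarrow> real^3"
  assumes "open_interval I"
    and "frenet_curve I \<alpha>"
    and "evolute_direction_curve I \<alpha> \<beta>"
  shows "(plane_curve I \<alpha> \<longleftrightarrow> (\<exists>\<gamma>. helix I \<gamma> \<and> involute_donor_curve I \<alpha> \<gamma>)) \<and>
         (plane_curve I \<alpha> \<longleftrightarrow> (\<exists>\<gamma>. evolute_direction_curve I \<alpha> \<gamma> \<and> helix I \<gamma>)) \<and>
         (plane_curve I \<alpha> \<longleftrightarrow> (\<forall>\<gamma>. evolute_direction_curve I \<alpha> \<gamma> \<longrightarrow> helix I \<gamma>))"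
  using plane_curve_iff_evolute_direction_helix[OF assms(1)] assms(3)
  unfolding involute_donor_curve_def by blast

end
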